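(* Let $k\in\mathbb{N}$. There are real numbers $a_{k,0},a_{k,1},\dots,a_{k,k-1}$ such that $$\frac1{(1-e^{-t})^k}=1+\sum_{i=1}^{k}a_{k,i-1}\biggl(\frac1{e^t-1}\biggr)^{(i-1)}\qquad\text{for all } t\ne0,$$ and the coefficients $a_{k,i-1}$ in this identity are given, for $1\le i\le k$, by $$a_{k,i-1}=(-1)^{i^2+1}\,|M_{k-i+1}(k,i)|,$$ where $|M_1(k,i)|=\frac1{(i-1)!}\binom{k}{i}$ and, for $2\le j\le k-i+1$, $$|M_j(k,i)|=\begin{vmatrix} \frac1{(i-1)!}\binom{k}{i} & S(i+1,i) & \cdots & S(i+j-1,i)\\ \frac1{i!}\binom{k}{i+1} & S(i+1,i+1) & \cdots & S(i+j-1,i+1)\\ \frac1{(i+1)!}\binom{k}{i+2} & 0 & \cdots & S(i+j-1,i+2)\\ \vdots & \vdots & \ddots & \vdots\\ \frac1{(i+j-2)!}\binom{k}{i+j-1} & 0 & \cdots & S(i+j-1,i+j-1) \end{vmatrix}.$$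
   Context: $\mathbb{N}$ is the set of positive integers and $t$ is a real variable. For a function $f$ of $t$, $f^{(n)}$ denotes the $n$-th derivative with respect to $t$, with $f^{(0)}=f$. For $1\le m\le n$, $S(n,m)=\frac1{m!}\sum_{\ell=0}^m(-1)^{m-\ell}\binom{m}{\ell}\ell^{n}$ are the Stirling numbers of the second kind. Explicitly, $|M_j(k,i)|$ is the determinant of the $j\times j$ matrix whose $(r,1)$ entry is $\frac{1}{(i+r-2)!}\binom{k}{i+r-1}$ for $1\le r\le j$, and whose $(r,c)$ entry for $2\le c\le j$ is $S(i+c-1,i+r-1)$ if $r\le c$ and $0$ if $r>c$. *)

theory Defs
  imports
    "HOL-Analysis.Derivative"
    "HOL-Combinatorics.Stirling"
    "Jordan_Normal_Form.Determinant"
begin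

lemma Stirling_explicit:
  "real (Stirling n m) =
    1 / fact m * (\<Sum>l=0..m. (-1) ^ (m - l) * real (m choose l) * real l ^ n)"
proof -
  define T :: "nat \<Rightarrow> nat \<Rightarrow> real" where
    "T n m = (\<Sum>l=0..m. (-1) ^ (m - l) * real (m choose l) * real l ^ n)" for n m
  have T0: "T 0 m = (if m = 0 then 1 else 0)" for m
  proof -
    have "T 0 m = (\<Sum>l\<le>m. real (m choose l) * 1 ^ l * (-1) ^ (m - l))"
      unfolding T_def by (intro sum.cong) auto
    also have "\<dots> = (1 + (-1)) ^ m"
      by (simp only: binomial_ring)
    finally show ?thesis by (simp add: power_0_left)
  qed
  have TS0: "T (Suc n) 0 = 0" for n
    by (simp add: T_def)
  have absorb: "real l * real (Suc m choose l) =
      real (Suc m) * (real (Suc m choose l) - real (m choose l))" for l m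
  proof (cases l)
    case (Suc j)
    have "Suc j * (Suc m choose Suc j) = Suc m * (m choose j)"
      by (rule Suc_times_binomial)
    then have "real (Suc j) * real (Suc m choose Suc j) = real (Suc m) * real (m choose j)"
      by (metis of_nat_mult)
    with Suc show ?thesis by simp
  qed simp
  have TSS: "T (Suc n) (Suc m) = real (Suc m) * (T n (Suc m) + T n m)" for n m
  proof -
    have "T (Suc n) (Suc m) = (\<Sum>l=0..Suc m. (-1) ^ (Suc m - l) *
        (real l * real (Suc m choose l)) * real l ^ n)"
      unfolding T_def by (intro sum.cong) (auto simp: mult_ac)
    also have "\<dots> = real (Suc m) * (T n (Suc m) -
        (\<Sum>l=0..Suc m. (-1) ^ (Suc m - l) * real (m choose l) * real l ^ n))"
      unfolding T_def absorb sum_subtractf[symmetric] sum_distrib_left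
      by (intro sum.cong) (auto simp: algebra_simps)
    also have "(\<Sum>l=0..Suc m. (-1) ^ (Suc m - l) * real (m choose l) * real l ^ n) =
        (\<Sum>l=0..m. (-1) ^ (Suc m - l) * real (m choose l) * real l ^ n)"
      by simp
    also have "\<dots> = - T n m"
      unfolding T_def sum_negf[symmetric] by (intro sum.cong) (auto simp: Suc_diff_le)
    finally show ?thesis by simp
  qed
  have "T n m = fact m * real (Stirling n m)"
  proof (induction n m rule: Stirling.induct)
    case (4 n m)
    then show ?case by (simp add: TSS algebra_simps)
  qed (simp_all add: T0 TS0)
  then show ?thesis by (simp add: T_def)
qed

text \<open>The row and column indices \<open>r\<close>, \<open>c\<close> below start at 1, as in the display of the
  determinant, whereas \<^const>\<open>mat\<close> indexes from 0.\<close>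

definition M_entry :: "nat \<Rightarrow> nat \<Rightarrow> nat \<Rightarrow> nat \<Rightarrow> real" where
  "M_entry k i r c =
    (if c = 1 then 1 / fact (i + r - 2) * real (k choose (i + r - 1))
     else if r \<le> c then real (Stirling (i + c - 1) (i + r - 1))
     else 0)"

definition M_det :: "nat \<Rightarrow> nat \<Rightarrow> nat \<Rightarrow> real" where
  "M_det j k i = det (mat j j (\<lambda>(r, c). M_entry k i (r + 1) (c + 1)))"

definition expansion_identity :: "nat \<Rightarrow> (nat \<Rightarrow> real) \<Rightarrow> bool" where
  "expansion_identity k a \<longleftrightarrow>
    (\<forall>t::real. t \<noteq> 0 \<longrightarrow>
      1 / (1 - exp (- t)) ^ k =
        1 + (\<Sum>i=1..k. a (i - 1) * (deriv ^^ (i - 1)) (\<lambda>s. 1 / (exp s - 1)) t))"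

end

theory Submission
  imports Defs
begin

text \<open>
  Put \<open>u = 1 / (exp t - 1)\<close>. Then \<open>1 / (1 - exp (-t)) = 1 + u\<close>, so the left-hand side is
  a polynomial in \<open>u\<close> by the binomial theorem. On the other side \<open>u' = - (u + u\<^sup>2)\<close>, so every
  derivative of \<open>u\<close> is a polynomial in \<open>u\<close> as well, and the recurrence
  of the Stirling numbers of the second kind gives its coefficients
  (\<open>higher_deriv_inverse_exp_minus_one\<close>).

  As \<open>t\<close> ranges over the positive reals, \<open>u\<close> takes every positive value, and a polynomial with
  infinitely many zeros vanishes. The expansion therefore holds exactly if the coefficients of all
  powers of \<open>u\<close> agree, which is a linear system for the numbers \<open>(-1) ^ q * a q\<close>
  (\<open>expansion_identity_iff\<close>). Its matrix of Stirling numbers is upper triangular with ones on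
  the diagonal. Back substitution gives existence of a solution
  (\<open>upper_unitriangular_solvable\<close>). For the value of a given unknown one drops the equations
  and unknowns before it; the rest is again such a system, and Cramer's rule writes its
  first unknown as the determinant in which the right-hand side replaces the first column
  (\<open>upper_unitriangular_Cramer\<close>).
\<close>

text \<open>Back substitution: the last unknown is the last right-hand side, and moving its
  contribution to the other side leaves a smaller system.\<close>

lemma upper_unitriangular_solvable:
  fixes T :: "nat \<Rightarrow> nat \<Rightarrow> 'a::comm_ring_1"
  assumes diag: "\<And>r. T r r = 1" and upper: "\<And>r c. c < r \<Longrightarrow> T r c = 0"
  shows "\<exists>x. \<forall>r<n. y r = (\<Sum>c<n. T r c * x c)"
proof (induction n arbitrary: y)
  case 0
  then show ?case by simp
next
  case (Suc n)
  from Suc.IH[of "\<lambda>r. y r - T r n * y n"]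
  obtain x where x: "\<forall>r<n. y r - T r n * y n = (\<Sum>c<n. T r c * x c)" by blast
  have "y r = (\<Sum>c<Suc n. T r c * (x(n := y n)) c)" if "r < Suc n" for r
  proof (cases "r = n")
    case True
    have "(\<Sum>c<n. T n c * (x(n := y n)) c) = 0"
      by (intro sum.neutral) (simp add: upper)
    with True show ?thesis by (simp add: diag)
  next
    case False
    with that x have "y r - T r n * y n = (\<Sum>c<n. T r c * x c)" by simp
    moreover have "(\<Sum>c<n. T r c * (x(n := y n)) c) = (\<Sum>c<n. T r c * x c)"
      by (intro sum.cong) auto
    ultimately show ?thesis by (simp add: algebra_simps)
  qed
  then show ?case by blast
qed

text \<open>The matrix on the left is the product of \<open>T\<close> and the identity matrix whose
  first column has been replaced by \<open>x\<close>. Both factors are triangular, with determinants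
  1 and \<open>x 0\<close>.\<close>

lemma upper_unitriangular_Cramer:
  fixes T :: "nat \<Rightarrow> nat \<Rightarrow> 'a::comm_ring_1"
  assumes diag: "\<And>r. T r r = 1" and upper: "\<And>r c. c < r \<Longrightarrow> T r c = 0"
    and sys: "\<And>r. r < n \<Longrightarrow> y r = (\<Sum>c<n. T r c * x c)" and "n > 0"
  shows "det (mat n n (\<lambda>(r, c). if c = 0 then y r else T r c)) = x 0"
proof -
  define A where "A = mat n n (\<lambda>(r, c). T r c)"
  define B where "B = mat n n (\<lambda>(r, c). if c = 0 then x r else if r = c then 1 else 0)"
  have A: "A \<in> carrier_mat n n" and B: "B \<in> carrier_mat n n"
    by (simp_all add: A_def B_def)
  have "mat n n (\<lambda>(r, c). if c = 0 then y r else T r c) = A * B"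
  proof (rule eq_matI)
    fix r c assume "r < dim_row (A * B)" "c < dim_col (A * B)"
    then have rc: "r < n" "c < n" by (simp_all add: A_def B_def)
    then have "(A * B) $$ (r, c) =
        (\<Sum>j<n. T r j * (if c = 0 then x j else if j = c then 1 else 0))"
      by (simp add: A_def B_def scalar_prod_def atLeast0LessThan)
    also have "\<dots> = (if c = 0 then y r else T r c)"
    proof (cases "c = 0")
      case True
      with rc show ?thesis by (simp add: sys)
    next
      case False
      have "(\<Sum>j<n. T r j * (if j = c then 1 else 0)) = (\<Sum>j<n. if j = c then T r j else 0)"
        by (intro sum.cong) auto
      with False rc show ?thesis by simp
    qed
    finally show "mat n n (\<lambda>(r, c). if c = 0 then y r else T r c) $$ (r, c) = (A * B) $$ (r, c)"
      using rc by simp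
  qed (simp_all add: A_def B_def)
  moreover have "det A = 1"
  proof -
    have "upper_triangular A" by (auto simp: A_def upper)
    then have "det A = prod_list (diag_mat A)" using A by (rule det_upper_triangular)
    also have "diag_mat A = map (\<lambda>i. 1) [0..<n]"
      by (simp add: diag_mat_def A_def diag)
    finally show ?thesis by (simp add: map_replicate_const)
  qed
  moreover have "det B = x 0"
  proof -
    have "det B = prod_list (diag_mat B)"
      by (rule det_lower_triangular[OF _ B]) (simp add: B_def)
    also have "diag_mat B = x 0 # map (\<lambda>i. 1) [Suc 0..<n]"
      using \<open>n > 0\<close> by (simp add: diag_mat_def B_def upt_conv_Cons)
    also have "prod_list \<dots> = x 0" by (simp add: map_replicate_const)
    finally show ?thesis .
  qed
  ultimately show ?thesis using det_mult[OF A B] by simp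
qed

text \<open>By \<open>u' = - (u + u\<^sup>2)\<close>, differentiating a term \<open>u ^ m\<close> produces
  \<open>- m * (u ^ m + u ^ (m + 1))\<close>. Collecting powers turns this into the recurrence
  \<open>S(n+1, m) = m * S(n, m) + S(n, m - 1)\<close>, with the factorials absorbing the extra factor.\<close>

lemma higher_deriv_inverse_exp_minus_one:
  fixes t :: real
  assumes "t \<noteq> 0"
  shows "(deriv ^^ n) (\<lambda>s. 1 / (exp s - 1)) t =
    (-1) ^ n * (\<Sum>p\<le>n. fact p * real (Stirling (Suc n) (Suc p)) * (1 / (exp t - 1)) ^ Suc p)"
  using assms
proof (induction n arbitrary: t)
  case 0
  then show ?case by simp
next
  case (Suc n)
  define u :: "real \<Rightarrow> real" where "u = (\<lambda>s. 1 / (exp s - 1))"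
  define F where
    "F = (\<lambda>s. (-1) ^ n * (\<Sum>p\<le>n. fact p * real (Stirling (Suc n) (Suc p)) * u s ^ Suc p))"
  have IH: "(deriv ^^ n) u s = F s" if "s \<noteq> 0" for s
    using Suc.IH[OF that] by (simp add: F_def u_def)
  from Suc.prems have "\<forall>\<^sub>F s in nhds t. s \<noteq> 0"
    by (rule t1_space_nhds)
  then have "\<forall>\<^sub>F s in nhds t. (deriv ^^ n) u s = F s"
    by (rule eventually_mono) (rule IH)
  then have "(deriv ^^ Suc n) u t = deriv F t"
    by (simp add: deriv_cong_ev)
  also have "deriv F t = (-1) ^ n * (\<Sum>p\<le>n. fact p * real (Stirling (Suc n) (Suc p)) *
      (real (Suc p) * u t ^ p * (- (u t + u t ^ 2))))"
  proof (rule DERIV_imp_deriv)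
    have nz: "exp t - 1 \<noteq> 0" using Suc.prems by simp
    have "(u has_real_derivative - (exp t / (exp t - 1) ^ 2)) (at t)"
      unfolding u_def using nz by (auto intro!: derivative_eq_intros simp: power2_eq_square)
    moreover have "exp t / (exp t - 1) ^ 2 = u t + u t ^ 2"
    proof -
      have "exp t / (exp t - 1) ^ 2 = ((exp t - 1) + 1) / (exp t - 1) ^ 2" by simp
      also have "\<dots> = u t + u t ^ 2"
        unfolding add_divide_distrib using nz by (simp add: u_def power2_eq_square)
      finally show ?thesis .
    qed
    ultimately have du: "(u has_real_derivative - (u t + u t ^ 2)) (at t)" by simp
    have "((\<lambda>s. u s ^ Suc p) has_real_derivative
        real (Suc p) * u t ^ p * (- (u t + u t ^ 2))) (at t)" for p
      using DERIV_power[OF du, of "Suc p"] by (simp add: algebra_simps)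
    then show "(F has_real_derivative (-1) ^ n * (\<Sum>p\<le>n. fact p *
        real (Stirling (Suc n) (Suc p)) * (real (Suc p) * u t ^ p * (- (u t + u t ^ 2))))) (at t)"
      unfolding F_def by (intro DERIV_cmult DERIV_sum)
  qed
  also have "\<dots> = (-1) ^ Suc n * (\<Sum>p\<le>n. fact (Suc p) * real (Stirling (Suc n) (Suc p)) *
      (u t ^ Suc p + u t ^ Suc (Suc p)))"
    unfolding sum_distrib_left
    by (intro sum.cong) (simp_all add: algebra_simps power2_eq_square del: Stirling.simps)
  also have "(\<Sum>p\<le>n. fact (Suc p) * real (Stirling (Suc n) (Suc p)) *
      (u t ^ Suc p + u t ^ Suc (Suc p))) =
    (\<Sum>p\<le>n. fact (Suc p) * real (Stirling (Suc n) (Suc p)) * u t ^ Suc p) +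
    (\<Sum>p\<le>n. fact (Suc p) * real (Stirling (Suc n) (Suc p)) * u t ^ Suc (Suc p))"
    by (simp only: distrib_left sum.distrib)
  also have "(\<Sum>p\<le>n. fact (Suc p) * real (Stirling (Suc n) (Suc p)) * u t ^ Suc p) =
    (\<Sum>p\<le>Suc n. fact (Suc p) * real (Stirling (Suc n) (Suc p)) * u t ^ Suc p)"
    by (simp del: Stirling.simps)
  also have "(\<Sum>p\<le>n. fact (Suc p) * real (Stirling (Suc n) (Suc p)) * u t ^ Suc (Suc p)) =
    (\<Sum>p\<le>Suc n. fact p * real (Stirling (Suc n) p) * u t ^ Suc p)"
    unfolding sum.atMost_Suc_shift by simp
  also have "(\<Sum>p\<le>Suc n. fact (Suc p) * real (Stirling (Suc n) (Suc p)) * u t ^ Suc p) +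
      (\<Sum>p\<le>Suc n. fact p * real (Stirling (Suc n) p) * u t ^ Suc p) =
    (\<Sum>p\<le>Suc n. fact p * real (Stirling (Suc (Suc n)) (Suc p)) * u t ^ Suc p)"
    unfolding sum.distrib[symmetric] Stirling.simps(4)[of "Suc n"]
    by (intro sum.cong) (simp_all add: algebra_simps del: Stirling.simps)
  finally show ?case by (simp only: u_def)
qed

text \<open>The two sides of the expansion differ by \<open>u\<close> times a polynomial in \<open>u\<close> of degree
  less than \<open>k\<close>, and \<open>u\<close> is nonzero with infinitely many values. So comparing coefficients is
  an equivalence.\<close>

lemma expansion_identity_iff:
  "expansion_identity k a \<longleftrightarrow>
    (\<forall>p<k. real (k choose Suc p) / fact p =
      (\<Sum>q<k. real (Stirling (Suc q) (Suc p)) * ((-1) ^ q * a q)))"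
proof -
  define u :: "real \<Rightarrow> real" where "u = (\<lambda>s. 1 / (exp s - 1))"
  define d where "d p = real (k choose Suc p) -
    fact p * (\<Sum>q<k. real (Stirling (Suc q) (Suc p)) * ((-1) ^ q * a q))" for p
  have key: "1 / (1 - exp (- t)) ^ k -
      (1 + (\<Sum>i=1..k. a (i - 1) * (deriv ^^ (i - 1)) u t)) = u t * (\<Sum>p<k. d p * u t ^ p)"
    if "t \<noteq> 0" for t
  proof -
    have nz: "exp t - 1 \<noteq> 0" using that by simp
    have "1 - exp (- t) = (exp t - 1) / exp t" by (simp add: exp_minus field_simps)
    then have "1 / (1 - exp (- t)) = u t + 1" using nz by (simp add: u_def field_simps)
    then have "1 / (1 - exp (- t)) ^ k = (u t + 1) ^ k"
      by (simp flip: power_one_over)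
    also have "\<dots> = (\<Sum>p<Suc k. real (k choose p) * u t ^ p)"
      by (simp add: binomial_ring lessThan_Suc_atMost)
    also have "\<dots> = 1 + (\<Sum>p<k. real (k choose Suc p) * u t ^ Suc p)"
      by (simp only: sum.lessThan_Suc_shift) simp
    finally have L: "1 / (1 - exp (- t)) ^ k = 1 + (\<Sum>p<k. real (k choose Suc p) * u t ^ Suc p)" .
    have "(\<Sum>i=1..k. a (i - 1) * (deriv ^^ (i - 1)) u t) =
        (\<Sum>q<k. a q * (deriv ^^ q) u t)"
      by (rule sum.reindex_bij_witness[of _ Suc "\<lambda>i. i - 1"]) auto
    also have "\<dots> = (\<Sum>q<k. \<Sum>p<k. fact p * real (Stirling (Suc q) (Suc p)) *
        ((-1) ^ q * a q) * u t ^ Suc p)"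
    proof (intro sum.cong refl)
      fix q assume "q \<in> {..<k}"
      \<comment> \<open>The Stirling numbers vanish for \<open>p > q\<close>, so the inner sum may run up to \<open>k\<close>.\<close>
      then have "(\<Sum>p\<le>q. fact p * real (Stirling (Suc q) (Suc p)) * u t ^ Suc p) =
          (\<Sum>p<k. fact p * real (Stirling (Suc q) (Suc p)) * u t ^ Suc p)"
        by (intro sum.mono_neutral_left) (auto simp del: Stirling.simps)
      then show "a q * (deriv ^^ q) u t = (\<Sum>p<k. fact p * real (Stirling (Suc q) (Suc p)) *
          ((-1) ^ q * a q) * u t ^ Suc p)"
        using higher_deriv_inverse_exp_minus_one[OF that, of q]
        by (simp add: u_def sum_distrib_left mult_ac del: Stirling.simps)
    qed
    also have "\<dots> = (\<Sum>p<k. fact p * (\<Sum>q<k. real (Stirling (Suc q) (Suc p)) *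
        ((-1) ^ q * a q)) * u t ^ Suc p)"
      by (subst sum.swap) (simp add: sum_distrib_left sum_distrib_right mult_ac del: Stirling.simps)
    finally show ?thesis
      unfolding L d_def
      by (simp add: sum_distrib_left sum_subtractf[symmetric] algebra_simps del: Stirling.simps)
  qed
  have "1 / (1 - exp (- t)) ^ k = 1 + (\<Sum>i=1..k. a (i - 1) * (deriv ^^ (i - 1)) u t) \<longleftrightarrow>
      (\<Sum>p<k. d p * u t ^ p) = 0" if "t \<noteq> 0" for t
  proof -
    have "u t \<noteq> 0" using that by (simp add: u_def)
    then show ?thesis
      unfolding eq_iff_diff_eq_0[of "1 / (1 - exp (- t)) ^ k"] key[OF that] by simp
  qed
  then have "expansion_identity k a \<longleftrightarrow> (\<forall>t. t \<noteq> 0 \<longrightarrow> (\<Sum>p<k. d p * u t ^ p) = 0)"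
    unfolding expansion_identity_def u_def[symmetric] by blast
  also have "\<dots> \<longleftrightarrow> (\<forall>p<k. d p = 0)"
  proof
    assume *: "\<forall>t. t \<noteq> 0 \<longrightarrow> (\<Sum>p<k. d p * u t ^ p) = 0"
    have zero: "(\<Sum>p<k. d p * x ^ p) = 0" if "x > 0" for x
    proof -
      \<comment> \<open>This is the solution \<open>t\<close> of \<open>1 / (exp t - 1) = x\<close>.\<close>
      define t where "t = ln (1 + 1 / x)"
      have "t > 0" "u t = x"
        using that by (simp_all add: t_def u_def add_pos_pos)
      with * show ?thesis by force
    qed
    show "\<forall>p<k. d p = 0"
    proof (cases k)
      case (Suc n)
      have "infinite {x::real. (\<Sum>p\<le>n. d p * x ^ p) = 0}"
        using zero infinite_Ioi[of "0::real"] unfolding Suc lessThan_Suc_atMost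
        by (elim contrapos_nn) (rule finite_subset, auto)
      then show ?thesis
        unfolding polyfun_finite_roots Suc by (auto simp: less_Suc_eq_le)
    qed simp
  qed simp
  also have "\<dots> \<longleftrightarrow> (\<forall>p<k. real (k choose Suc p) / fact p =
      (\<Sum>q<k. real (Stirling (Suc q) (Suc p)) * ((-1) ^ q * a q)))"
    by (simp add: d_def divide_eq_eq mult.commute del: Stirling.simps)
  finally show ?thesis .
qed

theorem theorem1p1:
  fixes k :: nat
  assumes "k \<ge> 1"
  shows "(\<exists>a. expansion_identity k a) \<and>
    (\<forall>a. expansion_identity k a \<longrightarrow>
      (\<forall>i\<in>{1..k}. a (i - 1) = (-1) ^ (i\<^sup>2 + 1) * M_det (k - i + 1) k i))"
proof (intro conjI allI impI ballI)
  obtain x where x: "\<forall>p<k. real (k choose Suc p) / fact p =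
      (\<Sum>q<k. real (Stirling (Suc q) (Suc p)) * x q)"
    using upper_unitriangular_solvable[of "\<lambda>p q. real (Stirling (Suc q) (Suc p))" k
        "\<lambda>p. real (k choose Suc p) / fact p"]
    by (auto simp del: Stirling.simps)
  have "expansion_identity k (\<lambda>q. (-1) ^ q * x q)"
    unfolding expansion_identity_iff using x
    by (simp add: mult.assoc[symmetric] power_add[symmetric] mult_2[symmetric]
        del: Stirling.simps)
  then show "\<exists>a. expansion_identity k a" by blast
next
  fix a i assume a: "expansion_identity k a" and i: "i \<in> {1..k}"
  define n where "n = k - i + 1"
  define b where "b q = (-1) ^ q * a q" for q
  have sys: "real (k choose (i + r)) / fact (i + r - 1) =
      (\<Sum>c<n. real (Stirling (i + c) (i + r)) * b (i - 1 + c))" if "r < n" for r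
  proof -
    have "i - 1 + r < k" "Suc (i - 1 + r) = i + r" using that i by (auto simp: n_def)
    then have "real (k choose (i + r)) / fact (i + r - 1) =
        (\<Sum>q<k. real (Stirling (Suc q) (i + r)) * b q)"
      using a unfolding expansion_identity_iff b_def
      by (metis diff_Suc_1)
    \<comment> \<open>The unknowns before \<open>b (i - 1)\<close> do not occur in this equation.\<close>
    also have "\<dots> = (\<Sum>q\<in>{i-1..<k}. real (Stirling (Suc q) (i + r)) * b q)"
      using i by (intro sum.mono_neutral_right) (auto simp del: Stirling.simps)
    also have "\<dots> = (\<Sum>c<n. real (Stirling (i + c) (i + r)) * b (i - 1 + c))"
      using i by (intro sum.reindex_bij_witness[of _ "\<lambda>c. i - 1 + c" "\<lambda>q. q - (i - 1)"])
        (auto simp: n_def simp del: Stirling.simps)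
    finally show ?thesis .
  qed
  have "M_det n k i = det (mat n n (\<lambda>(r, c).
      if c = 0 then real (k choose (i + r)) / fact (i + r - 1)
      else real (Stirling (i + c) (i + r))))"
    unfolding M_det_def M_entry_def
    by (intro arg_cong[where f = det] eq_matI) (auto simp del: Stirling.simps)
  also have "\<dots> = b (i - 1 + 0)"
    by (rule upper_unitriangular_Cramer[where T = "\<lambda>r c. real (Stirling (i + c) (i + r))" and
          x = "\<lambda>c. b (i - 1 + c)", OF _ _ sys]) (simp_all add: n_def del: Stirling.simps)
  finally have "M_det n k i = b (i - 1)" by simp
  moreover have "(-1) ^ (i\<^sup>2 + 1) = (-1 :: real) ^ (i - 1)"
    using i by (cases "even i") auto
  ultimately show "a (i - 1) = (-1) ^ (i\<^sup>2 + 1) * M_det (k - i + 1) k i"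
    by (simp add: n_def b_def mult.assoc[symmetric] power_add[symmetric] mult_2[symmetric])
qed

end
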